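(* Let $(\mathcal{V},d)$ be a metric space, let $V=\{v_1,\dots,v_N\}\subseteq\mathcal{V}$ be a finite set, and let $2\le k\le N$. Let $d^*=\max_{S'\subseteq V,\,|S'|=k} div(S')$. Let a cover tree with base $b>1$ be given for $V$, let $C_i$ be its termination layer (the layer with $|C_i|\ge k$ and $|C_j|<k$ for all $j>i$), and define $\beta>0$ by $b^i=d^*/\beta$. Let $S^{\mathrm{ICT\,Inherit}}\subseteq C_i$ be the set of $k$ nodes obtained as follows: initialize $S\leftarrow C_{i+1}$; while $|S|<k$, add a point $s^*\in\arg\max_{c\in C_i\setminus(S\cup C_{i+1})}\min_{s\in S}d(c,s)$. Then $$div\big(S^{\mathrm{ICT\,Inherit}}\big)\ \ge\ \max\left\{\frac{d^*}{\beta},\ \frac12\,d^*\left(1-\frac{1}{\beta}\cdot\frac{2b}{b-1}\right)\right\},$$ and consequently $$\frac{d^*}{div\big(S^{\mathrm{ICT\,Inherit}}\big)}\ \le\ 2+\frac{2b}{b-1}.$$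
   Context: For a finite set $S'\subseteq\mathcal{V}$ with at least two points, $div(S')=\min_{s,s'\in S',\,s\ne s'} d(s,s')$. A cover tree for $V$ with base $b>1$ is a leveled tree whose layers are indexed by integers $i$ with $i_{\min}\le i\le i_{\max}$; each node corresponds to a point of $V$ (at most one node per point per layer); $C_i$ denotes the set of (points of) nodes at level $i$; $C_{i_{\min}}=V$ and $C_{i_{\max}}$ consists of a single root. Invariants for all levels: (Nesting) $C_i\subseteq C_{i-1}$; (Covering) for every $p\in C_{i-1}$ there is $q\in C_i$ with $d(p,q)\le b^i$, and the node of $q$ is the parent of the node of $p$; (Separation) for all distinct $p,q\in C_i$, $d(p,q)>b^i$. *)

theory Defs
  imports "HOL-Analysis.Abstract_Metric_Spaces"
begin

text \<open>Only meaningful for finite sets with at least two points.\<close>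

definition diversity :: "('a \<Rightarrow> 'a \<Rightarrow> real) \<Rightarrow> 'a set \<Rightarrow> real" where
  "diversity d S = Min {d s s' | s s'. s \<in> S \<and> s' \<in> S \<and> s \<noteq> s'}"

definition max_diversity :: "('a \<Rightarrow> 'a \<Rightarrow> real) \<Rightarrow> 'a set \<Rightarrow> nat \<Rightarrow> real" where
  "max_diversity d V k = Max {diversity d S | S. S \<subseteq> V \<and> card S = k}"

text \<open>
  Since a layer has at most one node per point, the node of a point p at level i is
  represented by the pair of i and p, and the layer by its set of points \<open>C i\<close>.
  For a node p of a level \<open>i < imax\<close>, \<open>parent i p\<close> is the point of its parent node,
  which lies at level \<open>i + 1\<close>. The values of \<open>C\<close> and \<open>parent\<close> outside of the tree are
  irrelevant.
\<close>

locale cover_tree = Metric_space M d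
  for M :: "'a set" and d :: "'a \<Rightarrow> 'a \<Rightarrow> real" +
  fixes V :: "'a set" and b :: real and imin imax :: int
    and C :: "int \<Rightarrow> 'a set" and parent :: "int \<Rightarrow> 'a \<Rightarrow> 'a"
  assumes points_subset: "V \<subseteq> M"
    and finite_points: "finite V"
    and base_gt_1: "b > 1"
    and levels: "imin \<le> imax"
    and bottom: "C imin = V"
    and root: "\<exists>r. C imax = {r}"
    and nesting: "\<And>i. imin < i \<Longrightarrow> i \<le> imax \<Longrightarrow> C i \<subseteq> C (i - 1)"
    and covering: "\<And>i p. imin < i \<Longrightarrow> i \<le> imax \<Longrightarrow> p \<in> C (i - 1) \<Longrightarrow>
      parent (i - 1) p \<in> C i \<and> d p (parent (i - 1) p) \<le> b powi i"
    and separation: "\<And>i p q. imin \<le> i \<Longrightarrow> i \<le> imax \<Longrightarrow> p \<in> C i \<Longrightarrow> q \<in> C i \<Longrightarrow>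
      p \<noteq> q \<Longrightarrow> d p q > b powi i"

definition termination_layer :: "(int \<Rightarrow> 'a set) \<Rightarrow> int \<Rightarrow> int \<Rightarrow> nat \<Rightarrow> int \<Rightarrow> bool" where
  "termination_layer C imin imax k i \<longleftrightarrow>
     imin \<le> i \<and> i \<le> imax \<and> card (C i) \<ge> k \<and> (\<forall>j. i < j \<and> j \<le> imax \<longrightarrow> card (C j) < k)"

text \<open>
  The states of the greedy loop that starts with \<open>U\<close> and adds points of \<open>L\<close>; ties in the
  arg max may be broken arbitrarily, so the loop is a relation rather than a function.
\<close>

inductive inherit_state ::
  "('a \<Rightarrow> 'a \<Rightarrow> real) \<Rightarrow> 'a set \<Rightarrow> 'a set \<Rightarrow> nat \<Rightarrow> 'a set \<Rightarrow> bool"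
  for d :: "'a \<Rightarrow> 'a \<Rightarrow> real" and L U :: "'a set" and k :: nat where
  init: "inherit_state d L U k U"
| step: "inherit_state d L U k S \<Longrightarrow> card S < k \<Longrightarrow>
    is_arg_max (\<lambda>c. MIN s\<in>S. d c s) (\<lambda>c. c \<in> L - (S \<union> U)) s \<Longrightarrow>
    inherit_state d L U k (insert s S)"

definition ict_inherit ::
  "('a \<Rightarrow> 'a \<Rightarrow> real) \<Rightarrow> (int \<Rightarrow> 'a set) \<Rightarrow> nat \<Rightarrow> int \<Rightarrow> 'a set \<Rightarrow> bool" where
  "ict_inherit d C k i S \<longleftrightarrow> inherit_state d (C i) (C (i + 1)) k S \<and> \<not> card S < k"

end

theory Submission
  imports Defs
begin

text \<open>
  Let \<open>A\<close> be an optimal set, with diversity \<open>D\<close>. Summing the covering radii along the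
  path of ancestors, every point is within \<open>R = b powi (i + 1) / (b - 1)\<close> of an ancestor in
  the layer \<open>i\<close>. If the greedy loop has fewer than \<open>k\<close> points, two points of \<open>A\<close> cannot be
  close to the same one of them, so some point of \<open>A\<close> has an ancestor at distance at least
  \<open>D / 2 - R\<close> from all of them, and the greedy choice is at least as good. The same
  pigeonhole argument for the layer \<open>i + 1\<close>, which has fewer than \<open>k\<close> points, bounds \<open>D\<close> by
  \<open>2 * b * R\<close>; hence \<open>D / 2 - R \<le> b powi (i + 1)\<close>, and the initial points are also far enough
  apart. The separation of the layer \<open>i\<close> gives the other lower bound.
\<close>

section \<open>Diversity of finite sets and a pigeonhole principle\<close>

lemma pairwise_distances_finite:
  assumes "finite S"
  shows "finite {d s s' | s s'. s \<in> S \<and> s' \<in> S \<and> s \<noteq> s'}"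
proof (rule finite_subset)
  show "{d s s' | s s'. s \<in> S \<and> s' \<in> S \<and> s \<noteq> s'} \<subseteq> (\<lambda>(s, s'). d s s') ` (S \<times> S)"
    by auto
qed (use assms in simp)

text \<open>The cardinality bound does two jobs: an infinite set has \<open>card\<close> 0, so
  \<open>S\<close> is finite, and two distinct points make the set under \<open>Min\<close>
  nonempty.\<close>

lemma diversity_ge_iff:
  assumes "card S \<ge> 2"
  shows "x \<le> diversity d S \<longleftrightarrow> (\<forall>s\<in>S. \<forall>s'\<in>S. s \<noteq> s' \<longrightarrow> x \<le> d s s')"
proof -
  have "finite S"
    using assms by (metis card.infinite not_numeral_le_zero)
  moreover obtain s s' where "s \<in> S" "s' \<in> S" "s \<noteq> s'"
    using assms by (meson card_2_iff' ex_card subsetD)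
  then have "{d s s' | s s'. s \<in> S \<and> s' \<in> S \<and> s \<noteq> s'} \<noteq> {}"
    by blast
  ultimately show ?thesis
    unfolding diversity_def by (subst Min_ge_iff) (auto intro: pairwise_distances_finite)
qed

lemma max_diversity_attained:
  assumes "finite V" and "k \<le> card V"
  obtains A where "A \<subseteq> V" and "card A = k" and "diversity d A = max_diversity d V k"
proof -
  let ?X = "{diversity d S | S. S \<subseteq> V \<and> card S = k}"
  have "?X \<subseteq> diversity d ` Pow V"
    by auto
  then have "finite ?X"
    using assms(1) finite_subset by auto
  moreover have "?X \<noteq> {}"
    using ex_card[OF assms(2)] by blast
  ultimately have "max_diversity d V k \<in> ?X"
    unfolding max_diversity_def by (rule Max_in)
  then show ?thesis
    using that by auto
qed

lemma pigeonhole_rel: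
  assumes "finite T" and "card T < card A" and "\<And>a. a \<in> A \<Longrightarrow> \<exists>t\<in>T. P a t"
  obtains a a' t where "a \<in> A" "a' \<in> A" "a \<noteq> a'" "t \<in> T" "P a t" "P a' t"
proof -
  obtain f where f: "\<And>a. a \<in> A \<Longrightarrow> f a \<in> T \<and> P a (f a)"
    using assms(3) by metis
  have "card (f ` A) \<le> card T"
    using f assms(1) by (intro card_mono) auto
  then have "\<not> inj_on f A"
    using assms(2) card_image by fastforce
  then show ?thesis
    using that f by (metis inj_onI)
qed

section \<open>The greedy loop\<close>

lemma inherit_state_subset:
  assumes "inherit_state d L U k S" and "U \<subseteq> L"
  shows "U \<subseteq> S \<and> S \<subseteq> L"
  using assms by (induction rule: inherit_state.induct) (auto simp: is_arg_max_def)

text \<open>Separation by \<open>\<delta>\<close> is a loop invariant: if some candidate is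
  \<open>\<delta>\<close>-far from the current state, so is the arg max. \<open>far\<close> ranges
  over all small \<open>T\<close> between \<open>U\<close> and \<open>L\<close>, since nothing more
  is known about the states reached.\<close>

lemma inherit_state_separated:
  fixes d :: "'a \<Rightarrow> 'a \<Rightarrow> real"
  assumes "inherit_state d L U k S" and "finite L" and "U \<subseteq> L" and "U \<noteq> {}"
    and sym: "\<And>x y. d x y = d y x"
    and init: "\<And>x y. x \<in> U \<Longrightarrow> y \<in> U \<Longrightarrow> x \<noteq> y \<Longrightarrow> \<delta> \<le> d x y"
    and far: "\<And>T. U \<subseteq> T \<Longrightarrow> T \<subseteq> L \<Longrightarrow> card T < k \<Longrightarrow> \<exists>c\<in>L - T. \<forall>t\<in>T. \<delta> \<le> d c t"
  shows "\<forall>x\<in>S. \<forall>y\<in>S. x \<noteq> y \<longrightarrow> \<delta> \<le> d x y"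
  using assms(1)
proof (induction rule: inherit_state.induct)
  case init
  then show ?case
    using assms(6) by blast
next
  case (step S s)
  have sub: "U \<subseteq> S" "S \<subseteq> L"
    using inherit_state_subset[OF step.hyps(1) assms(3)] by auto
  then have S: "finite S" "S \<noteq> {}"
    using assms(2,4) finite_subset by auto
  obtain c where c: "c \<in> L - S" "\<forall>t\<in>S. \<delta> \<le> d c t"
    using far sub step.hyps(2) by blast
  have "\<delta> \<le> (MIN t\<in>S. d c t)"
    using c S by simp
  \<comment> \<open>As \<open>U \<subseteq> S\<close>, the candidates are exactly the points of
    \<open>L - S\<close>, so \<open>c\<close> competes with \<open>s\<close>.\<close>
  also have "\<dots> \<le> (MIN t\<in>S. d s t)"
    using step.hyps(3) c sub unfolding is_arg_max_def by (metis Diff_iff linorder_not_le Un_absorb2)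
  finally have "\<forall>t\<in>S. \<delta> \<le> d s t"
    using S by simp
  then show ?case
    using step.IH sym by auto
qed

section \<open>Distances in the cover tree\<close>

context cover_tree
begin

lemma layer_subset_points:
  assumes "imin \<le> i" and "i \<le> imax"
  shows "C i \<subseteq> V"
  using assms
proof (induction i rule: int_ge_induct)
  case base
  then show ?case
    using bottom by simp
next
  case (step i)
  then show ?case
    using nesting[of "i + 1"] by auto
qed

text \<open>The radius bounds the geometric series of the \<open>b powi j\<close> for
  \<open>j \<le> i\<close>. Adding the next radius \<open>b powi (i + 1)\<close> gives exactly the
  bound for the next layer, so the induction closes without loss.\<close>

lemma ancestor_close:
  assumes "imin \<le> i" and "i \<le> imax" and "p \<in> V"
  shows "\<exists>q\<in>C i. d p q \<le> b powi (i + 1) / (b - 1)"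
  using assms(1,2)
proof (induction i rule: int_ge_induct)
  case base
  have "d p p \<le> b powi (imin + 1) / (b - 1)"
    using base_gt_1 assms(3) points_subset by (subst mdist_zero) auto
  then show ?case
    using assms(3) bottom by blast
next
  case (step i)
  then obtain q where q: "q \<in> C i" "d p q \<le> b powi (i + 1) / (b - 1)"
    by auto
  let ?r = "parent i q"
  have r: "?r \<in> C (i + 1)" "d q ?r \<le> b powi (i + 1)"
    using covering[of "i + 1" q] step q by auto
  have "p \<in> M" "q \<in> M" "?r \<in> M"
    using layer_subset_points[of i] layer_subset_points[of "i + 1"] step q(1) r(1) assms(3)
      points_subset by auto
  then have "d p ?r \<le> d p q + d q ?r"
    by (rule triangle)
  also have "\<dots> \<le> b powi (i + 1) / (b - 1) + b powi (i + 1)"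
    using q(2) r(2) by simp
  also have "\<dots> = b powi (i + 1) * b / (b - 1)"
    using base_gt_1 by (simp add: field_simps)
  also have "\<dots> = b powi (i + 1 + 1) / (b - 1)"
    using base_gt_1 power_int_add_1[of b "i + 1"] by simp
  finally show ?case
    using r(1) by blast
qed

text \<open>Two points of \<open>A\<close> must share a nearby ancestor. This will be used one layer
  above the termination layer.\<close>

lemma diversity_le_small_layer:
  assumes "imin \<le> i" and "i \<le> imax" and "A \<subseteq> V" and "2 \<le> card A" and "card (C i) < card A"
  shows "diversity d A \<le> 2 * (b powi (i + 1) / (b - 1))"
proof -
  have sub: "C i \<subseteq> V"
    using assms(1,2) by (rule layer_subset_points)
  then have "finite (C i)"
    using finite_points finite_subset by blast
  then obtain a a' t where a: "a \<in> A" "a' \<in> A" "a \<noteq> a'" "t \<in> C i"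
      "d a t \<le> b powi (i + 1) / (b - 1)" "d a' t \<le> b powi (i + 1) / (b - 1)"
    using pigeonhole_rel[of "C i" A "\<lambda>a t. d a t \<le> b powi (i + 1) / (b - 1)"]
      ancestor_close[OF assms(1,2)] assms(3,5) by (metis subsetD)
  have "diversity d A \<le> d a a'"
    using diversity_ge_iff[OF assms(4)] a by blast
  also have "\<dots> \<le> d a t + d a' t"
    using a(1,2,4) assms(3) sub points_subset triangle[of a t a'] by (auto simp: commute[of t a'])
  finally show ?thesis
    using a by linarith
qed

text \<open>Otherwise each point of \<open>A\<close>, via its ancestor, would be closer than half
  the diversity to \<open>T\<close>, and two of them to the same point. That \<open>c\<close> lies
  outside \<open>T\<close> follows only when the bound is positive.\<close>

lemma layer_point_far:
  assumes "imin \<le> i" and "i \<le> imax" and "A \<subseteq> V" and "2 \<le> card A"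
    and "T \<subseteq> C i" and "card T < card A"
  shows "\<exists>c\<in>C i. \<forall>t\<in>T. diversity d A / 2 - b powi (i + 1) / (b - 1) \<le> d c t"
proof (rule ccontr)
  let ?R = "b powi (i + 1) / (b - 1)"
  assume none: "\<not> ?thesis"
  have sub: "C i \<subseteq> V"
    using assms(1,2) by (rule layer_subset_points)
  then have "finite T"
    using assms(5) finite_points finite_subset by (metis subset_trans)
  moreover have "\<exists>t\<in>T. d a t < diversity d A / 2" if "a \<in> A" for a
  proof -
    obtain q where q: "q \<in> C i" "d a q \<le> ?R"
      using ancestor_close[OF assms(1,2), of a] \<open>a \<in> A\<close> assms(3) by blast
    obtain t where t: "t \<in> T" "d q t < diversity d A / 2 - ?R"
      using none q(1) by force
    have "d a t \<le> d a q + d q t"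
      using that q(1) t(1) assms(3,5) sub points_subset by (intro triangle) auto
    then show ?thesis
      using q(2) t by force
  qed
  ultimately obtain a a' t where a: "a \<in> A" "a' \<in> A" "a \<noteq> a'" "t \<in> T"
      "d a t < diversity d A / 2" "d a' t < diversity d A / 2"
    using pigeonhole_rel[of T A "\<lambda>a t. d a t < diversity d A / 2"] assms(6) by metis
  have "diversity d A \<le> d a a'"
    using diversity_ge_iff[OF assms(4)] a by blast
  also have "\<dots> \<le> d a t + d a' t"
    using a(1,2,4) assms(3,5) sub points_subset triangle[of a t a']
    by (auto simp: commute[of t a'])
  finally show False
    using a by linarith
qed

lemma ict_inherit_diversity:
  assumes "2 \<le> k" and "termination_layer C imin imax k i" and "ict_inherit d C k i S"
    and "A \<subseteq> V" and "card A = k"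
  shows "b powi i \<le> diversity d S"
    and "diversity d A / 2 - b powi (i + 1) / (b - 1) \<le> diversity d S"
proof -
  let ?\<delta> = "diversity d A / 2 - b powi (i + 1) / (b - 1)"
  have i: "imin \<le> i" "i \<le> imax" "k \<le> card (C i)"
    and above: "\<And>j. i < j \<Longrightarrow> j \<le> imax \<Longrightarrow> card (C j) < k"
    using assms(2) by (auto simp: termination_layer_def)
  \<comment> \<open>The root layer has one point and \<open>2 \<le> k\<close>, so there is a layer
    \<open>i + 1\<close> to initialize from.\<close>
  have "i \<noteq> imax"
    using root i(3) assms(1) by auto
  then have i1: "imin < i + 1" "imin \<le> i + 1" "i + 1 \<le> imax" "card (C (i + 1)) < k"
    using i above[of "i + 1"] by auto
  have S: "inherit_state d (C i) (C (i + 1)) k S" "2 \<le> card S"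
    using assms(1,3) by (auto simp: ict_inherit_def)
  have nest: "C (i + 1) \<subseteq> C i"
    using nesting[of "i + 1"] i1 by simp
  have fin: "finite (C i)"
    using layer_subset_points[OF i(1,2)] finite_points finite_subset by blast
  have sub: "S \<subseteq> C i"
    using inherit_state_subset[OF S(1) nest] by simp
  show sep: "b powi i \<le> diversity d S"
    using separation[OF i(1,2)] sub diversity_ge_iff[OF S(2)] by (meson less_imp_le subsetD)
  show "?\<delta> \<le> diversity d S"
  \<comment> \<open>A nonpositive threshold is covered by the separation of layer \<open>i\<close>;
    a positive one is needed to find new points for the loop.\<close>
  proof (cases "?\<delta> \<le> 0")
    case True
    moreover have "0 \<le> b powi i"
      using base_gt_1 by simp
    ultimately show ?thesis
      using sep by linarith
  next
    case False
    have "diversity d A \<le> 2 * (b powi (i + 1 + 1) / (b - 1))"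
      using diversity_le_small_layer[OF i1(2,3) assms(4)] assms(1,5) i1(4) by simp
    \<comment> \<open>The ancestor radii of layers \<open>i + 1\<close> and \<open>i\<close> differ
      by exactly the separation of layer \<open>i + 1\<close>, which is what the initial points
      need.\<close>
    moreover have "b powi (i + 1 + 1) / (b - 1) - b powi (i + 1) / (b - 1) = b powi (i + 1)"
      using base_gt_1 power_int_add_1[of b "i + 1"]
      by (simp add: diff_divide_distrib[symmetric] divide_eq_eq right_diff_distrib)
    ultimately have \<delta>: "?\<delta> \<le> b powi (i + 1)"
      by linarith
    \<comment> \<open>The root serves as some point of \<open>V\<close>; its ancestor in layer
      \<open>i + 1\<close> shows that the loop starts from a nonempty set.\<close>
    obtain r where r: "C imax = {r}"
      using root by blast
    have "r \<in> V"
      using layer_subset_points[OF levels order_refl] r by simp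
    then have "C (i + 1) \<noteq> {}"
      using ancestor_close[OF i1(2,3)] by blast
    moreover have "?\<delta> \<le> d x y" if "x \<in> C (i + 1)" "y \<in> C (i + 1)" "x \<noteq> y" for x y
      using separation[OF i1(2,3) that] \<delta> by linarith
    moreover have "\<exists>c\<in>C i - T. \<forall>t\<in>T. ?\<delta> \<le> d c t" if T: "T \<subseteq> C i" "card T < k" for T
    proof -
      obtain c where c: "c \<in> C i" "\<forall>t\<in>T. ?\<delta> \<le> d c t"
        using layer_point_far[OF i(1,2) assms(4) _ T(1)] T(2) assms(1,5) by blast
      \<comment> \<open>A point of \<open>T\<close> has distance 0 to itself, below the positive
        threshold.\<close>
      have "c \<in> M"
        using c(1) layer_subset_points[OF i(1,2)] points_subset by blast
      then have "d c c = 0"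
        by simp
      then have "c \<notin> T"
        using c(2) False by force
      then show ?thesis
        using c by blast
    qed
    ultimately have "\<forall>x\<in>S. \<forall>y\<in>S. x \<noteq> y \<longrightarrow> ?\<delta> \<le> d x y"
      by (intro inherit_state_separated[OF S(1) fin nest]) (auto simp: commute)
    then show ?thesis
      using diversity_ge_iff[OF S(2)] by blast
  qed
qed

end

section \<open>The approximation guarantee\<close>

theorem theorem2:
  fixes M V S :: "'a set" and d :: "'a \<Rightarrow> 'a \<Rightarrow> real"
    and b \<beta> dstar :: real and k :: nat and i imin imax :: int
    and C :: "int \<Rightarrow> 'a set" and parent :: "int \<Rightarrow> 'a \<Rightarrow> 'a"
  assumes "Metric_space M d"
    and "V \<subseteq> M" and "finite V"
    and "2 \<le> k" and "k \<le> card V"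
    and "dstar = max_diversity d V k"
    and "b > 1"
    and "cover_tree M d V b imin imax C parent"
    and "termination_layer C imin imax k i"
    and "\<beta> > 0" and "b powi i = dstar / \<beta>"
    and "ict_inherit d C k i S"
  shows "diversity d S \<ge> max (dstar / \<beta>) (1 / 2 * dstar * (1 - 1 / \<beta> * (2 * b / (b - 1))))
    \<and> dstar / diversity d S \<le> 2 + 2 * b / (b - 1)"
proof -
  interpret cover_tree M d V b imin imax C parent
    by fact
  obtain A where A: "A \<subseteq> V" "card A = k" "diversity d A = dstar"
    using max_diversity_attained[OF \<open>finite V\<close> \<open>k \<le> card V\<close>] \<open>dstar = max_diversity d V k\<close>
    by metis
  let ?x = "diversity d S"
  define c R where c: "c = 2 * b / (b - 1)" and R: "R = b powi (i + 1) / (b - 1)"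
  have x: "b powi i \<le> ?x" "dstar / 2 - R \<le> ?x"
    using ict_inherit_diversity[OF \<open>2 \<le> k\<close> assms(9,12) A(1,2)] A(3) R by auto
  have "b powi (i + 1) = b powi i * b"
    using \<open>b > 1\<close> by (simp add: power_int_add_1)
  then have eq: "2 * R = b powi i * c"
    by (simp add: c R)
  have "1 / 2 * dstar * (1 - 1 / \<beta> * c) = dstar / 2 - dstar / \<beta> * c / 2"
    by (simp add: right_diff_distrib)
  also have "\<dots> \<le> ?x"
    using x(2) unfolding \<open>b powi i = dstar / \<beta>\<close>[symmetric] eq[symmetric] by simp
  finally have lower: "1 / 2 * dstar * (1 - 1 / \<beta> * c) \<le> ?x" .
  have pos: "0 < ?x"
    using x(1) zero_less_power_int[of b i] \<open>b > 1\<close> by linarith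
  have "dstar \<le> 2 * ?x + b powi i * c"
    using x(2) eq by linarith
  \<comment> \<open>The separation bound absorbs the remaining \<open>b powi i\<close>, which
    removes \<open>\<beta>\<close> from the ratio.\<close>
  also have "\<dots> \<le> 2 * ?x + ?x * c"
    using x(1) \<open>b > 1\<close> by (intro add_left_mono mult_right_mono) (auto simp: c)
  finally have "dstar / ?x \<le> 2 + c"
    using pos by (simp add: pos_divide_le_eq algebra_simps)
  moreover have "dstar / \<beta> \<le> ?x"
    using x(1) unfolding \<open>b powi i = dstar / \<beta>\<close> .
  ultimately show ?thesis
    using lower unfolding c by (intro conjI max.boundedI)
qed

end
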